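(* Given a Fixed-Permutation Linear Model (FPLM) over $x=(x_1,\dots,x_n)$ of dimension $k$, there exists a D&C SPN of size $O(nk^2)$ which computes the same function of $x$.
   Context: FPLM: let $x=(x_1,\dots,x_n)$ with $x_i\in R_i\subseteq\mathbb{R}$. An FPLM is given by a fixed permutation $\pi$ of $\{1,\dots,n\}$, a dimension $k$, vectors $a,b\in\mathbb{R}_{\ge0}^k$, and for each $i$ a matrix-valued function $T_i$ from values of $x_i$ to $\mathbb{R}_{\ge0}^{k\times k}$. Its output is $b^\top T_{\pi(n)}(x_{\pi(n)})T_{\pi(n-1)}(x_{\pi(n-1)})\cdots T_{\pi(1)}(x_{\pi(1)})a$. The entries of the $T_i$ are assumed to be admissible univariate functions for SPNs, i.e. to have finite $M_i$-integral over $R_i$ (see below). Arithmetic circuits: an arithmetic circuit $\Phi$ over a tuple of variables $y$ is a finite directed acyclic graph with a unique node of out-degree $0$ (the root). Each node of in-degree $0$ is labeled by a variable of $y$ or a real constant; every other node is labeled $\times$ (product node) or $+$ (sum node), and edges into sum nodes carry real weights. The children $C(u)$ of $u$ are the nodes with an edge into $u$. Labeled leaves compute their labels, a product node computes $q_u=\prod_{v\in C(u)}q_v$, a sum node computes $q_u=\sum_{v\in C(u)}w_{v,u}q_v$; $q_\Phi$ is the polynomial computed by the root. $\Phi$ is monotone if all weights and constants are non-negative. The size is the number of nodes. SPNs: let $M_i$ be a measure on $R_i$ and let $f$ be a tuple of non-negative univariate functions $f_{i,j}(x_i)$, each with finite $M_i$-integral. A Sum Product Network (SPN) is a monotone arithmetic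 circuit over $f$ (the choice of $f$ is part of the SPN); it computes the function $x\mapsto q_\Phi(f(x))$. The dependency-scope of a node $u$ is the set of those $x_i$ such that some $f_{i,j}$ labels a node in the sub-circuit rooted at $u$. An SPN is decomposable if for every product node the dependency-scopes of its children are pairwise disjoint, complete if for every sum node the dependency-scopes of its children are all equal, and a D&C SPN if it is both. *)

theory Defs
  imports
    "HOL-Analysis.Bochner_Integration"
    "HOL-Combinatorics.Permutations"
    "HOL-Library.Disjoint_Sets"
    "HOL-Library.Poly_Mapping"
    "Jordan_Normal_Form.Matrix"
begin

section \<open>Admissible univariate functions\<close>

definition admissible :: "real set \<Rightarrow> real measure \<Rightarrow> (real \<Rightarrow> real) \<Rightarrow> bool" where
  "admissible R M g \<longleftrightarrow> (\<forall>z\<in>R. 0 \<le> g z) \<and> integrable M g"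

section \<open>Fixed-permutation linear models\<close>

text \<open>The model variables are indexed by \<open>{1..n}\<close>, while rows and columns of the matrices are
  indexed by \<open>{..<k}\<close>, as usual for the matrix type used here.\<close>

record fplm =
  fplm_perm :: "nat \<Rightarrow> nat"
  fplm_dim :: nat
  fplm_init :: "real Matrix.vec"
  fplm_final :: "real Matrix.vec"
  fplm_trans :: "nat \<Rightarrow> real \<Rightarrow> real mat"

definition is_fplm :: "nat \<Rightarrow> (nat \<Rightarrow> real set) \<Rightarrow> (nat \<Rightarrow> real measure) \<Rightarrow> fplm \<Rightarrow> bool" where
  "is_fplm n R M F \<longleftrightarrow>
     (let k = fplm_dim F; a = fplm_init F; b = fplm_final F; T = fplm_trans F in
      fplm_perm F permutes {1..n} \<and>
      a \<in> carrier_vec k \<and> (\<forall>p<k. 0 \<le> vec_index a p) \<and>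
      b \<in> carrier_vec k \<and> (\<forall>p<k. 0 \<le> vec_index b p) \<and>
      (\<forall>i\<in>{1..n}.
         (\<forall>z\<in>R i. T i z \<in> carrier_mat k k) \<and>
         (\<forall>p<k. \<forall>q<k. admissible (R i) (M i) (\<lambda>z. index_mat (T i z) (p, q)))))"

text \<open>\<open>fplm_prod F x t\<close> is the product of the first \<open>t\<close> matrices, the latest one standing
  leftmost.\<close>

primrec fplm_prod :: "fplm \<Rightarrow> (nat \<Rightarrow> real) \<Rightarrow> nat \<Rightarrow> real mat" where
  "fplm_prod F x 0 = 1\<^sub>m (fplm_dim F)"
| "fplm_prod F x (Suc t) =
     fplm_trans F (fplm_perm F (Suc t)) (x (fplm_perm F (Suc t))) * fplm_prod F x t"

definition fplm_fun :: "nat \<Rightarrow> fplm \<Rightarrow> (nat \<Rightarrow> real) \<Rightarrow> real" where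
  "fplm_fun n F x = scalar_prod (fplm_final F) (mult_mat_vec (fplm_prod F x n) (fplm_init F))"

section \<open>Multivariate polynomials\<close>

text \<open>A monomial maps each variable to its exponent; a polynomial maps each monomial to its
  coefficient.\<close>

type_synonym 'y polynomial = "('y \<Rightarrow>\<^sub>0 nat) \<Rightarrow>\<^sub>0 real"

definition poly_var :: "'y \<Rightarrow> 'y polynomial" where
  "poly_var y = Poly_Mapping.single (Poly_Mapping.single y 1) 1"

definition poly_const :: "real \<Rightarrow> 'y polynomial" where
  "poly_const c = Poly_Mapping.single 0 c"

definition poly_eval :: "'y polynomial \<Rightarrow> ('y \<Rightarrow> real) \<Rightarrow> real" where
  "poly_eval p g =
     (\<Sum>m\<in>Poly_Mapping.keys p.
        Poly_Mapping.lookup p m * (\<Prod>y\<in>Poly_Mapping.keys m. g y ^ Poly_Mapping.lookup m y))"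

section \<open>Arithmetic circuits\<close>

datatype 'y gate = Var 'y | Const real | Times | Plus

text \<open>Edges point from a child to its parent, so the root has no outgoing edge. Labels and weights
  are total functions; only their values on nodes, and on edges into sum nodes, matter.\<close>

record ('v, 'y) circuit =
  nodes :: "'v set"
  edges :: "('v \<times> 'v) set"
  label :: "'v \<Rightarrow> 'y gate"
  weight :: "'v \<times> 'v \<Rightarrow> real"

definition children :: "('v, 'y) circuit \<Rightarrow> 'v \<Rightarrow> 'v set" where
  "children \<Phi> u = {v. (v, u) \<in> edges \<Phi>}"

definition is_root :: "('v, 'y) circuit \<Rightarrow> 'v \<Rightarrow> bool" where
  "is_root \<Phi> u \<longleftrightarrow> u \<in> nodes \<Phi> \<and> (\<nexists>w. (u, w) \<in> edges \<Phi>)"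

definition root :: "('v, 'y) circuit \<Rightarrow> 'v" where
  "root \<Phi> = (THE u. is_root \<Phi> u)"

definition arithmetic_circuit :: "'y set \<Rightarrow> ('v, 'y) circuit \<Rightarrow> bool" where
  "arithmetic_circuit Y \<Phi> \<longleftrightarrow>
     finite (nodes \<Phi>) \<and> edges \<Phi> \<subseteq> nodes \<Phi> \<times> nodes \<Phi> \<and> acyclic (edges \<Phi>) \<and>
     (\<exists>!u. is_root \<Phi> u) \<and>
     (\<forall>u\<in>nodes \<Phi>.
        if children \<Phi> u = {} then label \<Phi> u \<in> Var ` Y \<union> range Const
        else label \<Phi> u \<in> {Times, Plus})"

definition monotone_circuit :: "('v, 'y) circuit \<Rightarrow> bool" where
  "monotone_circuit \<Phi> \<longleftrightarrow>
     (\<forall>u\<in>nodes \<Phi>. \<forall>c. label \<Phi> u = Const c \<longrightarrow> 0 \<le> c) \<and>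
     (\<forall>u\<in>nodes \<Phi>. label \<Phi> u = Plus \<longrightarrow> (\<forall>v\<in>children \<Phi> u. 0 \<le> weight \<Phi> (v, u)))"

definition circuit_size :: "('v, 'y) circuit \<Rightarrow> nat" where
  "circuit_size \<Phi> = card (nodes \<Phi>)"

text \<open>The polynomial at a node is defined by well-founded recursion along the edges; the expected
  recursion equation is \<open>node_poly_unfold\<close> below.\<close>

definition node_step ::
  "('v, 'y) circuit \<Rightarrow> ('v \<Rightarrow> 'y polynomial) \<Rightarrow> 'v \<Rightarrow> 'y polynomial" where
  "node_step \<Phi> q u =
     (case label \<Phi> u of
        Var y \<Rightarrow> poly_var y
      | Const c \<Rightarrow> poly_const c
      | Times \<Rightarrow> (\<Prod>v\<in>children \<Phi> u. q v)
      | Plus \<Rightarrow> (\<Sum>v\<in>children \<Phi> u. poly_const (weight \<Phi> (v, u)) * q v))"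

definition node_poly :: "('v, 'y) circuit \<Rightarrow> 'v \<Rightarrow> 'y polynomial" where
  "node_poly \<Phi> = wfrec (edges \<Phi>) (node_step \<Phi>)"

definition circuit_poly :: "('v, 'y) circuit \<Rightarrow> 'y polynomial" where
  "circuit_poly \<Phi> = node_poly \<Phi> (root \<Phi>)"

lemma node_poly_unfold:
  assumes "arithmetic_circuit Y \<Phi>"
  shows "node_poly \<Phi> u =
     (case label \<Phi> u of
        Var y \<Rightarrow> poly_var y
      | Const c \<Rightarrow> poly_const c
      | Times \<Rightarrow> (\<Prod>v\<in>children \<Phi> u. node_poly \<Phi> v)
      | Plus \<Rightarrow> (\<Sum>v\<in>children \<Phi> u. poly_const (weight \<Phi> (v, u)) * node_poly \<Phi> v))"
proof -
  have "finite (edges \<Phi>)"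
    using assms by (auto simp: arithmetic_circuit_def intro: finite_subset)
  then have "wf (edges \<Phi>)"
    using assms by (simp add: arithmetic_circuit_def finite_acyclic_wf)
  then have "node_poly \<Phi> u = node_step \<Phi> (cut (node_poly \<Phi>) (edges \<Phi>) u) u"
    unfolding node_poly_def by (rule wfrec)
  also have "\<dots> = node_step \<Phi> (node_poly \<Phi>) u"
    by (simp add: node_step_def children_def cut_apply split: gate.split)
  finally show ?thesis
    by (simp add: node_step_def)
qed

section \<open>Sum product networks\<close>

text \<open>The univariate functions of an SPN form a finite tuple: the circuit variable \<open>(i, j)\<close>
  stands for \<open>f\<^sub>i\<^sub>,\<^sub>j\<close>, applied to \<open>x\<^sub>i\<close>, where \<open>j\<close> ranges over \<open>{1..spn_num S i}\<close>.\<close>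

record 'v spn =
  spn_circuit :: "('v, nat \<times> nat) circuit"
  spn_num :: "nat \<Rightarrow> nat"
  spn_univ :: "nat \<Rightarrow> nat \<Rightarrow> real \<Rightarrow> real"

definition is_spn :: "nat \<Rightarrow> (nat \<Rightarrow> real set) \<Rightarrow> (nat \<Rightarrow> real measure) \<Rightarrow> 'v spn \<Rightarrow> bool" where
  "is_spn n R M S \<longleftrightarrow>
     arithmetic_circuit (SIGMA i:{1..n}. {1..spn_num S i}) (spn_circuit S) \<and>
     monotone_circuit (spn_circuit S) \<and>
     (\<forall>i\<in>{1..n}. \<forall>j\<in>{1..spn_num S i}. admissible (R i) (M i) (spn_univ S i j))"

definition spn_fun :: "'v spn \<Rightarrow> (nat \<Rightarrow> real) \<Rightarrow> real" where
  "spn_fun S x = poly_eval (circuit_poly (spn_circuit S)) (\<lambda>(i, j). spn_univ S i j (x i))"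

text \<open>A variable \<open>x\<^sub>i\<close> is represented by its index \<open>i\<close>.\<close>

definition dependency_scope :: "'v spn \<Rightarrow> 'v \<Rightarrow> nat set" where
  "dependency_scope S u =
     {i. \<exists>v j. (v, u) \<in> (edges (spn_circuit S))\<^sup>* \<and> label (spn_circuit S) v = Var (i, j)}"

definition decomposable :: "'v spn \<Rightarrow> bool" where
  "decomposable S \<longleftrightarrow>
     (\<forall>u\<in>nodes (spn_circuit S). label (spn_circuit S) u = Times \<longrightarrow>
        disjoint_family_on (dependency_scope S) (children (spn_circuit S) u))"

definition complete_spn :: "'v spn \<Rightarrow> bool" where
  "complete_spn S \<longleftrightarrow>
     (\<forall>u\<in>nodes (spn_circuit S). label (spn_circuit S) u = Plus \<longrightarrow>
        (\<forall>v\<in>children (spn_circuit S) u. \<forall>w\<in>children (spn_circuit S) u.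
           dependency_scope S v = dependency_scope S w))"

definition dc_spn :: "nat \<Rightarrow> (nat \<Rightarrow> real set) \<Rightarrow> (nat \<Rightarrow> real measure) \<Rightarrow> 'v spn \<Rightarrow> bool" where
  "dc_spn n R M S \<longleftrightarrow> is_spn n R M S \<and> decomposable S \<and> complete_spn S"

end

theory Submission
  imports Defs "HOL-Library.Countable"
begin

text \<open>The SPN unrolls the matrix-vector products: the sum node \<open>State t q\<close> computes entry \<open>q\<close> of
  the vector obtained after \<open>t\<close> factors, as the sum over \<open>r\<close> of product nodes \<open>Step\<close> that multiply
  one matrix entry with \<open>State (t - 1) r\<close>. All nodes of layer \<open>t\<close> depend exactly on the first \<open>t\<close>
  variables in the order of the permutation. Hence sum nodes are complete, and product nodes are
  decomposable because the matrix entry brings in a new variable.\<close>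

section \<open>Evaluation of polynomials\<close>

definition monomial_eval :: "('y \<Rightarrow>\<^sub>0 nat) \<Rightarrow> ('y \<Rightarrow> real) \<Rightarrow> real" where
  "monomial_eval m g = (\<Prod>y\<in>Poly_Mapping.keys m. g y ^ Poly_Mapping.lookup m y)"

text \<open>Variables outside the support have exponent 0 and contribute the factor 1. Two monomials
  can therefore be evaluated over one common index set.\<close>

lemma monomial_eval_superset:
  assumes "finite Y" "Poly_Mapping.keys m \<subseteq> Y"
  shows "monomial_eval m g = (\<Prod>y\<in>Y. g y ^ Poly_Mapping.lookup m y)"
  unfolding monomial_eval_def using assms
  by (intro prod.mono_neutral_left) (auto simp: in_keys_iff)

lemma monomial_eval_add: "monomial_eval (m + m') g = monomial_eval m g * monomial_eval m' g"
proof -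
  let ?Y = "Poly_Mapping.keys m \<union> Poly_Mapping.keys m'"
  have "Poly_Mapping.keys (m + m') \<subseteq> ?Y"
    by (rule keys_add)
  then show ?thesis
    by (simp add: monomial_eval_superset[of ?Y] lookup_add power_add prod.distrib)
qed

lemma poly_eval_superset:
  assumes "finite K" "Poly_Mapping.keys p \<subseteq> K"
  shows "poly_eval p g = (\<Sum>m\<in>K. Poly_Mapping.lookup p m * monomial_eval m g)"
  unfolding poly_eval_def monomial_eval_def[symmetric] using assms
  by (intro sum.mono_neutral_left) (auto simp: in_keys_iff)

lemma poly_eval_add: "poly_eval (p + q) g = poly_eval p g + poly_eval q g"
proof -
  let ?K = "Poly_Mapping.keys p \<union> Poly_Mapping.keys q"
  have "Poly_Mapping.keys (p + q) \<subseteq> ?K"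
    by (rule keys_add)
  then show ?thesis
    by (simp add: poly_eval_superset[of ?K] lookup_add distrib_right sum.distrib)
qed

lemma poly_eval_single: "poly_eval (Poly_Mapping.single m c) g = c * monomial_eval m g"
  by (simp add: poly_eval_superset[of "{m}"])

text \<open>The rule \<open>update_induct\<close> extends a polynomial by a term at a fresh
  monomial. Read as a sum, each induction step for multiplicativity reduces to additivity and
  distributivity.\<close>

lemma update_eq_add_single:
  assumes "a \<notin> Poly_Mapping.keys p"
  shows "Poly_Mapping.update a b p = Poly_Mapping.single a b + p"
  using assms
  by (intro poly_mapping_eqI) (auto simp: lookup_update lookup_add lookup_single in_keys_iff when_def)

lemma poly_eval_0: "poly_eval 0 g = 0"
  by (simp add: poly_eval_def)

lemma poly_eval_single_mult:
  "poly_eval (Poly_Mapping.single m c * q) g = c * monomial_eval m g * poly_eval q g"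
  by (induction q rule: update_induct)
    (simp_all add: poly_eval_0 update_eq_add_single distrib_left poly_eval_add mult_single
      poly_eval_single monomial_eval_add)

lemma poly_eval_mult: "poly_eval (p * q) g = poly_eval p g * poly_eval q g"
  by (induction p rule: update_induct)
    (simp_all add: poly_eval_0 update_eq_add_single distrib_right poly_eval_add
      poly_eval_single_mult poly_eval_single)

lemma poly_eval_const: "poly_eval (poly_const c) g = c"
  by (simp add: poly_const_def poly_eval_single monomial_eval_def)

lemma poly_eval_var: "poly_eval (poly_var y) g = g y"
  by (simp add: poly_var_def poly_eval_single monomial_eval_def)

lemma poly_eval_sum: "poly_eval (\<Sum>i\<in>A. p i) g = (\<Sum>i\<in>A. poly_eval (p i) g)"
  by (induction A rule: infinite_finite_induct)
    (simp_all add: poly_eval_add poly_eval_0)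

lemma poly_eval_prod: "poly_eval (\<Prod>i\<in>A. p i) g = (\<Prod>i\<in>A. poly_eval (p i) g)"
proof -
  have "poly_eval 1 g = 1"
    using poly_eval_const[of 1 g] by (simp add: poly_const_def)
  then show ?thesis
    by (induction A rule: infinite_finite_induct) (simp_all add: poly_eval_mult)
qed

text \<open>Evaluation respects sums and products, so it commutes with the recursion of the circuit.
  From here on it suffices to compute real numbers at a fixed point.\<close>

lemma poly_eval_node_poly:
  assumes "arithmetic_circuit Y \<Phi>"
  shows "poly_eval (node_poly \<Phi> u) g =
     (case label \<Phi> u of
        Var y \<Rightarrow> g y
      | Const c \<Rightarrow> c
      | Times \<Rightarrow> (\<Prod>v\<in>children \<Phi> u. poly_eval (node_poly \<Phi> v) g)
      | Plus \<Rightarrow> (\<Sum>v\<in>children \<Phi> u. weight \<Phi> (v, u) * poly_eval (node_poly \<Phi> v) g))"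
  by (subst node_poly_unfold[OF assms])
    (simp add: poly_eval_var poly_eval_const poly_eval_sum poly_eval_prod poly_eval_mult
      split: gate.split)

text \<open>A path into \<open>u\<close> is empty or ends with an edge from a child of
  \<open>u\<close>. The scope, defined by reachability, thus gets a recursion and can be computed
  layer by layer.\<close>

lemma dependency_scope_unfold:
  "dependency_scope S u =
     {i. \<exists>j. label (spn_circuit S) u = Var (i, j)} \<union>
     (\<Union>v\<in>children (spn_circuit S) u. dependency_scope S v)"
proof -
  have scope: "dependency_scope S w =
      (\<Union>v\<in>{v. (v, w) \<in> (edges (spn_circuit S))\<^sup>*}.
        {i. \<exists>j. label (spn_circuit S) v = Var (i, j)})" for w
    by (auto simp: dependency_scope_def)
  have "{v. (v, u) \<in> (edges (spn_circuit S))\<^sup>*} =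
      insert u (\<Union>w\<in>children (spn_circuit S) u. {v. (v, w) \<in> (edges (spn_circuit S))\<^sup>*})"
    by (auto simp: children_def elim: rtranclE intro: rtrancl_into_rtrancl)
  then show ?thesis
    unfolding scope by (simp add: UN_UN_flatten)
qed

section \<open>The layered circuit of a model\<close>

text \<open>\<open>Step t q r\<close> sits between two layers: it is the contribution of
  \<open>State t r\<close> to \<open>State (Suc t) q\<close>. As \<open>t\<close> counts from 0,
  \<open>Entry t q r\<close> stands for entry \<open>(q, r)\<close> of factor
  \<open>Suc t\<close>.\<close>

datatype fplm_node = Entry nat nat nat | Step nat nat nat | State nat nat | Output

instance fplm_node :: countable
  by countable_datatype

fun fplm_kids :: "nat \<Rightarrow> nat \<Rightarrow> fplm_node \<Rightarrow> fplm_node set" where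
  "fplm_kids n k (Entry t q r) = {}"
| "fplm_kids n k (Step t q r) = {Entry t q r, State t r}"
| "fplm_kids n k (State 0 q) = {}"
| "fplm_kids n k (State (Suc t) q) = Step t q ` {..<k}"
| "fplm_kids n k Output = State n ` {..<k}"

fun fplm_label :: "fplm \<Rightarrow> fplm_node \<Rightarrow> (nat \<times> nat) gate" where
  "fplm_label F (Entry t q r) = Var (fplm_perm F (Suc t), Suc (q * fplm_dim F + r))"
| "fplm_label F (Step t q r) = Times"
| "fplm_label F (State 0 q) = Const (vec_index (fplm_init F) q)"
| "fplm_label F (State (Suc t) q) = Plus"
| "fplm_label F Output = Plus"

text \<open>Only the final vector becomes edge weights. Matrix entries vary with the input, so they
  must enter as leaves through product nodes.\<close>

fun fplm_weight :: "fplm \<Rightarrow> fplm_node \<Rightarrow> fplm_node \<Rightarrow> real" where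
  "fplm_weight F (State t q) Output = vec_index (fplm_final F) q"
| "fplm_weight F v u = 1"

definition fplm_nodes :: "nat \<Rightarrow> nat \<Rightarrow> fplm_node set" where
  "fplm_nodes n k =
     insert Output ((\<lambda>(t, q). State t q) ` ({..n} \<times> {..<k}) \<union>
       (\<lambda>(t, q, r). Step t q r) ` ({..<n} \<times> {..<k} \<times> {..<k}) \<union>
       (\<lambda>(t, q, r). Entry t q r) ` ({..<n} \<times> {..<k} \<times> {..<k}))"

text \<open>The nodes are encoded by \<open>to_nat\<close> because the network to be produced has
  natural numbers as nodes.\<close>

definition fplm_circuit :: "nat \<Rightarrow> fplm \<Rightarrow> (nat, nat \<times> nat) circuit" where
  "fplm_circuit n F =
     \<lparr>nodes = to_nat ` fplm_nodes n (fplm_dim F),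
      edges = {(to_nat v, to_nat u) | v u.
        u \<in> fplm_nodes n (fplm_dim F) \<and> v \<in> fplm_kids n (fplm_dim F) u},
      label = (\<lambda>u. fplm_label F (from_nat u)),
      weight = (\<lambda>(v, u). fplm_weight F (from_nat v) (from_nat u))\<rparr>"

text \<open>Matrix entry \<open>(p, q)\<close> is the univariate function number \<open>p * k + q + 1\<close>.\<close>

definition fplm_spn :: "nat \<Rightarrow> fplm \<Rightarrow> nat spn" where
  "fplm_spn n F =
     \<lparr>spn_circuit = fplm_circuit n F,
      spn_num = (\<lambda>i. fplm_dim F * fplm_dim F),
      spn_univ = (\<lambda>i j z. index_mat (fplm_trans F i z)
        ((j - 1) div fplm_dim F, (j - 1) mod fplm_dim F))\<rparr>"

lemma fplm_nodes_simps [simp]: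
  "Output \<in> fplm_nodes n k"
  "State t q \<in> fplm_nodes n k \<longleftrightarrow> t \<le> n \<and> q < k"
  "Step t q r \<in> fplm_nodes n k \<longleftrightarrow> t < n \<and> q < k \<and> r < k"
  "Entry t q r \<in> fplm_nodes n k \<longleftrightarrow> t < n \<and> q < k \<and> r < k"
  by (auto simp: fplm_nodes_def image_iff)

lemma finite_fplm_nodes: "finite (fplm_nodes n k)"
  by (simp add: fplm_nodes_def)

lemma card_fplm_nodes: "card (fplm_nodes n k) \<le> 1 + (Suc n * k + n * k\<^sup>2 + n * k\<^sup>2)"
  unfolding fplm_nodes_def
  by (rule order.trans[OF card_insert_le_m1])
    (auto intro!: order.trans[OF card_Un_le] add_mono order.trans[OF card_image_le]
      simp: card_cartesian_product power2_eq_square)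

lemma fplm_kids_in_nodes:
  assumes "u \<in> fplm_nodes n k" "v \<in> fplm_kids n k u"
  shows "v \<in> fplm_nodes n k"
  using assms by (cases "(n, k, u)" rule: fplm_kids.cases) auto

lemma fplm_circuit_simps [simp]:
  "nodes (fplm_circuit n F) = to_nat ` fplm_nodes n (fplm_dim F)"
  "label (fplm_circuit n F) (to_nat u) = fplm_label F u"
  "weight (fplm_circuit n F) (to_nat v, to_nat u) = fplm_weight F v u"
  by (simp_all add: fplm_circuit_def)

lemma children_fplm_circuit:
  assumes "u \<in> fplm_nodes n (fplm_dim F)"
  shows "children (fplm_circuit n F) (to_nat u) = to_nat ` fplm_kids n (fplm_dim F) u"
  using assms by (auto simp: children_def fplm_circuit_def)

lemma to_nat_edge_fplm_circuit:
  "(to_nat v, to_nat u) \<in> edges (fplm_circuit n F) \<longleftrightarrow>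
     u \<in> fplm_nodes n (fplm_dim F) \<and> v \<in> fplm_kids n (fplm_dim F) u"
  by (auto simp: fplm_circuit_def)

section \<open>Acyclicity, the root and the circuit conditions\<close>

fun fplm_rank :: "nat \<Rightarrow> fplm_node \<Rightarrow> nat" where
  "fplm_rank n (Entry t q r) = 2 * t"
| "fplm_rank n (Step t q r) = 2 * t + 1"
| "fplm_rank n (State t q) = 2 * t"
| "fplm_rank n Output = 2 * n + 1"

text \<open>States occupy the even ranks and steps the odd ranks between them. A strict increase
  along every edge rules out cycles.\<close>

lemma fplm_rank_kids: "v \<in> fplm_kids n k u \<Longrightarrow> fplm_rank n v < fplm_rank n u"
  by (cases "(n, k, u)" rule: fplm_kids.cases) auto

lemma acyclic_fplm_circuit: "acyclic (edges (fplm_circuit n F))"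
proof (rule acyclic_subset)
  show "acyclic (inv_image less_than (\<lambda>u. fplm_rank n (from_nat u)))"
    by (intro wf_acyclic wf_inv_image wf_less_than)
  show "edges (fplm_circuit n F) \<subseteq> inv_image less_than (\<lambda>u. fplm_rank n (from_nat u))"
    by (auto simp: fplm_circuit_def fplm_rank_kids)
qed

lemma is_root_fplm_circuit:
  assumes "1 \<le> fplm_dim F"
  shows "is_root (fplm_circuit n F) u \<longleftrightarrow> u = to_nat Output"
proof
  assume u: "is_root (fplm_circuit n F) u"
  then obtain v where v: "v \<in> fplm_nodes n (fplm_dim F)" "u = to_nat v"
    by (auto simp: is_root_def)
  \<comment> \<open>A root has no parent, so every node other than \<open>Output\<close> is excluded
    by naming one parent of it.\<close>
  have no: "\<not> (w \<in> fplm_nodes n (fplm_dim F) \<and> v \<in> fplm_kids n (fplm_dim F) w)" for w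
    using u v by (auto simp: is_root_def to_nat_edge_fplm_circuit[symmetric])
  show "u = to_nat Output"
  proof (cases v)
    case (Entry t q r)
    then show ?thesis using v no[of "Step t q r"] by auto
  next
    case (Step t q r)
    then show ?thesis using v no[of "State (Suc t) q"] by auto
  next
    case (State t q)
    \<comment> \<open>A state feeds \<open>Output\<close> in the last layer and a step otherwise;
      row 0 exists because the dimension is positive.\<close>
    then show ?thesis using v assms no[of "Step t 0 q"] no[of Output] by (cases "t = n") auto
  next
    case Output
    then show ?thesis using v by simp
  qed
next
  have "Output \<notin> fplm_kids n k w" for k w
    by (cases "(n, k, w)" rule: fplm_kids.cases) auto
  then show "u = to_nat Output \<Longrightarrow> is_root (fplm_circuit n F) u"
    by (auto simp: is_root_def fplm_circuit_def)
qed

lemma root_fplm_circuit: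
  assumes "1 \<le> fplm_dim F"
  shows "root (fplm_circuit n F) = to_nat Output"
  using assms by (simp add: root_def is_root_fplm_circuit)

lemma arithmetic_circuit_fplm_circuit:
  assumes "is_fplm n R M F" "1 \<le> fplm_dim F"
  shows "arithmetic_circuit (SIGMA i:{1..n}. {1..fplm_dim F * fplm_dim F}) (fplm_circuit n F)"
  unfolding arithmetic_circuit_def
proof (intro conjI ballI)
  let ?k = "fplm_dim F"
  let ?Y = "SIGMA i:{1..n}. {1..?k * ?k}"
  have perm: "fplm_perm F permutes {1..n}"
    using assms(1) by (simp add: is_fplm_def Let_def)
  show "finite (nodes (fplm_circuit n F))"
    by (simp add: finite_fplm_nodes)
  show "edges (fplm_circuit n F) \<subseteq> nodes (fplm_circuit n F) \<times> nodes (fplm_circuit n F)"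
    by (auto simp: fplm_circuit_def intro: fplm_kids_in_nodes)
  show "acyclic (edges (fplm_circuit n F))"
    by (rule acyclic_fplm_circuit)
  show "\<exists>!u. is_root (fplm_circuit n F) u"
    using assms(2) by (simp add: is_root_fplm_circuit)
  fix u assume "u \<in> nodes (fplm_circuit n F)"
  then obtain v where v: "v \<in> fplm_nodes n ?k" "u = to_nat v"
    by auto
  \<comment> \<open>A positive dimension gives every sum node a child; a childless one would be a
    leaf with an illegal label.\<close>
  have "0 < ?k"
    using assms(2) by simp
  have "fplm_label F (Entry t q r) \<in> Var ` ?Y" if "t < n" "q < ?k" "r < ?k" for t q r
  proof -
    have "fplm_perm F (Suc t) \<in> {1..n}"
      using that permutes_in_image[OF perm] by simp
    moreover have "Suc (q * ?k + r) \<le> ?k * ?k"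
    proof -
      have "Suc (q * ?k + r) \<le> Suc q * ?k"
        using that by simp
      also have "\<dots> \<le> ?k * ?k"
        using that by (intro mult_right_mono) auto
      finally show ?thesis .
    qed
    ultimately show ?thesis
      by simp
  qed
  then show "if children (fplm_circuit n F) u = {}
      then label (fplm_circuit n F) u \<in> Var ` ?Y \<union> range Const
      else label (fplm_circuit n F) u \<in> {Times, Plus}"
    using v \<open>0 < ?k\<close>
    by (cases "(n, ?k, v)" rule: fplm_kids.cases)
      (auto simp: children_fplm_circuit simp del: mult_Suc_right)
qed

lemma monotone_fplm_circuit:
  assumes "is_fplm n R M F"
  shows "monotone_circuit (fplm_circuit n F)"
proof -
  let ?k = "fplm_dim F"
  have init: "\<And>p. p < ?k \<Longrightarrow> 0 \<le> vec_index (fplm_init F) p"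
    and final: "\<And>p. p < ?k \<Longrightarrow> 0 \<le> vec_index (fplm_final F) p"
    using assms by (simp_all add: is_fplm_def Let_def)
  have "0 \<le> c" if "u \<in> fplm_nodes n ?k" "fplm_label F u = Const c" for u c
    using that init by (cases "(n, ?k, u)" rule: fplm_kids.cases) auto
  moreover have "0 \<le> fplm_weight F v u"
    if "u \<in> fplm_nodes n ?k" "v \<in> fplm_kids n ?k u" for u v
    using that final by (cases "(n, ?k, u)" rule: fplm_kids.cases) auto
  ultimately show ?thesis
    by (auto simp: monotone_circuit_def children_fplm_circuit)
qed

lemma is_spn_fplm_spn:
  assumes "is_fplm n R M F" "1 \<le> fplm_dim F"
  shows "is_spn n R M (fplm_spn n F)"
proof -
  let ?k = "fplm_dim F"
  have "admissible (R i) (M i) (\<lambda>z. index_mat (fplm_trans F i z) ((j - 1) div ?k, (j - 1) mod ?k))"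
    if "i \<in> {1..n}" "j \<in> {1..?k * ?k}" for i j
  proof -
    \<comment> \<open>Every number in the range decodes to a valid row and column, so the univariate
      function is an entry of the model.\<close>
    have "(j - 1) div ?k < ?k" "(j - 1) mod ?k < ?k"
      using that assms(2) by (auto intro!: less_mult_imp_div_less)
    then show ?thesis
      using that assms(1) by (simp add: is_fplm_def Let_def)
  qed
  then show ?thesis
    using assms arithmetic_circuit_fplm_circuit monotone_fplm_circuit
    by (auto simp: is_spn_def fplm_spn_def)
qed

section \<open>Dependency scopes\<close>

lemma dependency_scope_fplm_spn:
  assumes "u \<in> fplm_nodes n (fplm_dim F)"
  shows "dependency_scope (fplm_spn n F) (to_nat u) =
     {i. \<exists>j. fplm_label F u = Var (i, j)} \<union>
     (\<Union>v\<in>fplm_kids n (fplm_dim F) u. dependency_scope (fplm_spn n F) (to_nat v))"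
  by (subst dependency_scope_unfold)
    (simp add: fplm_spn_def children_fplm_circuit[OF assms])

lemma dependency_scope_Entry:
  assumes "t < n" "q < fplm_dim F" "r < fplm_dim F"
  shows "dependency_scope (fplm_spn n F) (to_nat (Entry t q r)) = {fplm_perm F (Suc t)}"
  using assms by (simp add: dependency_scope_fplm_spn)

text \<open>The initial constants have empty scope, and each further factor adds its own variable.
  Scopes are read off labels, so they do not depend on \<open>q\<close>, even where a matrix entry
  vanishes.\<close>

lemma dependency_scope_State:
  assumes "t \<le> n" "q < fplm_dim F"
  shows "dependency_scope (fplm_spn n F) (to_nat (State t q)) = fplm_perm F ` {1..t}"
  using assms
proof (induction t arbitrary: q)
  case 0
  then show ?case
    by (simp add: dependency_scope_fplm_spn)
next
  case (Suc t)
  have "dependency_scope (fplm_spn n F) (to_nat (Step t q r)) = fplm_perm F ` {1..Suc t}"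
    if "r < fplm_dim F" for r
    using Suc that
    by (simp add: dependency_scope_fplm_spn[of "Step t q r"] dependency_scope_Entry
        atLeastAtMostSuc_conv)
  then show ?case
    using Suc.prems by (auto simp: dependency_scope_fplm_spn[of "State (Suc t) q"])
qed

lemma dependency_scope_Step:
  assumes "t < n" "q < fplm_dim F" "r < fplm_dim F"
  shows "dependency_scope (fplm_spn n F) (to_nat (Step t q r)) = fplm_perm F ` {1..Suc t}"
  using assms
  by (simp add: dependency_scope_fplm_spn[of "Step t q r"] dependency_scope_Entry
      dependency_scope_State atLeastAtMostSuc_conv)

lemma decomposable_fplm_spn:
  assumes "is_fplm n R M F"
  shows "decomposable (fplm_spn n F)"
proof -
  let ?k = "fplm_dim F" and ?S = "fplm_spn n F"
  have inj: "inj (fplm_perm F)"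
    using assms permutes_inj by (auto simp: is_fplm_def Let_def)
  have "disjoint_family_on (dependency_scope ?S) (to_nat ` fplm_kids n ?k u)"
    if u: "u \<in> fplm_nodes n ?k" "fplm_label F u = Times" for u
  proof -
    obtain t q r where [simp]: "u = Step t q r"
      using u by (cases "(n, ?k, u)" rule: fplm_kids.cases) auto
    \<comment> \<open>No variable is read twice along the permutation, so the new entry shares none
      with the state below it.\<close>
    have "fplm_perm F (Suc t) \<notin> fplm_perm F ` {1..t}"
      by (simp add: inj_image_mem_iff[OF inj])
    then show ?thesis
      using u by (auto simp: disjoint_family_on_def dependency_scope_Entry dependency_scope_State)
  qed
  then show ?thesis
    by (auto simp: decomposable_def fplm_spn_def children_fplm_circuit)
qed

lemma complete_fplm_spn: "complete_spn (fplm_spn n F)"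
proof -
  let ?k = "fplm_dim F" and ?S = "fplm_spn n F"
  \<comment> \<open>The children of a sum node all lie in one layer; \<open>A\<close> is the scope
    of that layer.\<close>
  have "\<exists>A. \<forall>v\<in>fplm_kids n ?k u. dependency_scope ?S (to_nat v) = A"
    if "u \<in> fplm_nodes n ?k" "fplm_label F u = Plus" for u
    using that by (cases "(n, ?k, u)" rule: fplm_kids.cases)
      (auto simp: dependency_scope_Step dependency_scope_State)
  then show ?thesis
    unfolding complete_spn_def by (fastforce simp: fplm_spn_def children_fplm_circuit)
qed

section \<open>The computed function\<close>

text \<open>The model fixes the matrix dimensions only for arguments in \<open>R i\<close>, hence
  the restriction on \<open>x\<close>.\<close>

lemma fplm_trans_carrier:
  assumes "is_fplm n R M F" "x \<in> Pi {1..n} R" "t < n"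
  shows "fplm_trans F (fplm_perm F (Suc t)) (x (fplm_perm F (Suc t)))
    \<in> carrier_mat (fplm_dim F) (fplm_dim F)"
proof -
  have "fplm_perm F (Suc t) \<in> {1..n}"
    using assms by (subst permutes_in_image) (auto simp: is_fplm_def Let_def)
  then show ?thesis
    using assms(1,2) by (auto simp: is_fplm_def Let_def Pi_iff)
qed

lemma fplm_prod_carrier:
  assumes "is_fplm n R M F" "x \<in> Pi {1..n} R" "t \<le> n"
  shows "fplm_prod F x t \<in> carrier_mat (fplm_dim F) (fplm_dim F)"
  using assms(3)
  by (induction t) (auto intro!: mult_carrier_mat fplm_trans_carrier[OF assms(1,2)])

context
  fixes n :: nat and R :: "nat \<Rightarrow> real set" and M :: "nat \<Rightarrow> real measure" and F :: fplm
    and x :: "nat \<Rightarrow> real"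
  assumes F: "is_fplm n R M F" and dim: "1 \<le> fplm_dim F" and x: "x \<in> Pi {1..n} R"
begin

definition node_value :: "fplm_node \<Rightarrow> real" where
  "node_value u = poly_eval (node_poly (fplm_circuit n F) (to_nat u))
     (\<lambda>(i, j). spn_univ (fplm_spn n F) i j (x i))"

lemma node_value_unfold:
  assumes "u \<in> fplm_nodes n (fplm_dim F)"
  shows "node_value u =
     (case fplm_label F u of
        Var (i, j) \<Rightarrow> spn_univ (fplm_spn n F) i j (x i)
      | Const c \<Rightarrow> c
      | Times \<Rightarrow> (\<Prod>v\<in>fplm_kids n (fplm_dim F) u. node_value v)
      | Plus \<Rightarrow> (\<Sum>v\<in>fplm_kids n (fplm_dim F) u. fplm_weight F v u * node_value v))"
  unfolding node_value_def
  \<comment> \<open>Injectivity of \<open>to_nat\<close> turns sums and products over encoded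
    children into ones over \<open>fplm_kids\<close>.\<close>
  by (subst poly_eval_node_poly[OF arithmetic_circuit_fplm_circuit[OF F dim]])
    (simp add: children_fplm_circuit[OF assms] prod.reindex sum.reindex split: gate.split)

lemma node_value_Entry:
  assumes "t < n" "q < fplm_dim F" "r < fplm_dim F"
  shows "node_value (Entry t q r) =
     index_mat (fplm_trans F (fplm_perm F (Suc t)) (x (fplm_perm F (Suc t)))) (q, r)"
  using assms by (simp add: node_value_unfold fplm_spn_def)

lemma node_value_Step:
  assumes "t < n" "q < fplm_dim F" "r < fplm_dim F"
  shows "node_value (Step t q r) = node_value (Entry t q r) * node_value (State t r)"
  using assms by (simp add: node_value_unfold[of "Step t q r"])

lemma node_value_State:
  assumes "t \<le> n" "q < fplm_dim F"
  shows "node_value (State t q) = vec_index (mult_mat_vec (fplm_prod F x t) (fplm_init F)) q"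
  using assms
proof (induction t arbitrary: q)
  case 0
  have "fplm_init F \<in> carrier_vec (fplm_dim F)"
    using F by (simp add: is_fplm_def Let_def)
  with 0 show ?case
    by (simp add: node_value_unfold)
next
  case (Suc t)
  let ?k = "fplm_dim F"
  let ?T = "fplm_trans F (fplm_perm F (Suc t)) (x (fplm_perm F (Suc t)))"
  let ?v = "mult_mat_vec (fplm_prod F x t) (fplm_init F)"
  have T: "?T \<in> carrier_mat ?k ?k"
    using Suc.prems by (intro fplm_trans_carrier[OF F x]) simp
  have P: "fplm_prod F x t \<in> carrier_mat ?k ?k"
    using Suc.prems by (intro fplm_prod_carrier[OF F x]) simp
  have a: "fplm_init F \<in> carrier_vec ?k"
    using F by (simp add: is_fplm_def Let_def)
  have "node_value (State (Suc t) q) = (\<Sum>r<?k. node_value (Step t q r))"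
    using Suc.prems by (simp add: node_value_unfold[of "State (Suc t) q"] sum.reindex inj_on_def)
  also have "\<dots> = (\<Sum>r<?k. index_mat ?T (q, r) * vec_index ?v r)"
    using Suc by (simp add: node_value_Step node_value_Entry)
  also have "\<dots> = vec_index (mult_mat_vec ?T ?v) q"
    using Suc.prems T P by (auto simp: scalar_prod_def lessThan_atLeast0 intro!: sum.cong)
  \<comment> \<open>Associativity reconciles the two orders: the circuit applies each matrix to a
    vector, while \<open>fplm_prod\<close> multiplies the matrices first.\<close>
  also have "mult_mat_vec ?T ?v = mult_mat_vec (fplm_prod F x (Suc t)) (fplm_init F)"
    using T P a by (simp add: assoc_mult_mat_vec)
  finally show ?case .
qed

lemma spn_fun_fplm_spn: "spn_fun (fplm_spn n F) x = fplm_fun n F x"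
proof -
  let ?v = "mult_mat_vec (fplm_prod F x n) (fplm_init F)"
  have "spn_fun (fplm_spn n F) x = node_value Output"
    by (simp add: spn_fun_def circuit_poly_def node_value_def fplm_spn_def
        root_fplm_circuit[OF dim])
  \<comment> \<open>The weights into \<open>Output\<close> form the scalar product with the final
    vector.\<close>
  also have "\<dots> = (\<Sum>q<fplm_dim F. vec_index (fplm_final F) q * vec_index ?v q)"
    by (simp add: node_value_unfold[of Output] sum.reindex inj_on_def node_value_State)
  also have "\<dots> = fplm_fun n F x"
    using fplm_prod_carrier[OF F x order.refl]
    by (auto simp: fplm_fun_def scalar_prod_def lessThan_atLeast0)
  finally show ?thesis .
qed

end

section \<open>The size bound\<close>

lemma circuit_size_fplm_circuit:
  assumes "1 \<le> n" "1 \<le> fplm_dim F"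
  shows "circuit_size (fplm_circuit n F) \<le> 5 * (n * (fplm_dim F)\<^sup>2)"
proof -
  let ?k = "fplm_dim F"
  have "?k \<le> ?k\<^sup>2"
    using assms by (simp add: power2_eq_square)
  \<comment> \<open>The node count is at most \<open>1 + k + n * k + 2 * n * k^2\<close>. Each of
    the first three terms is at most \<open>n * k^2\<close>, which gives the constant 5.\<close>
  then have "n * ?k \<le> n * ?k\<^sup>2" "?k \<le> n * ?k\<^sup>2" "1 \<le> n * ?k\<^sup>2"
    using assms mult_le_mono[of 1 n ?k "?k\<^sup>2"] mult_le_mono[of 1 n 1 "?k\<^sup>2"] by simp_all
  moreover have "circuit_size (fplm_circuit n F) = card (fplm_nodes n ?k)"
    by (simp add: circuit_size_def card_image)
  ultimately show ?thesis
    using card_fplm_nodes[of n ?k] unfolding mult_Suc by linarith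
qed

theorem proposition20:
  shows "\<exists>C::nat. \<forall>(n::nat) (R :: nat \<Rightarrow> real set) (M :: nat \<Rightarrow> real measure) (F :: fplm).
    1 \<le> n \<longrightarrow> 1 \<le> fplm_dim F \<longrightarrow>
    (\<forall>i\<in>{1..n}. space (M i) = R i) \<longrightarrow>
    is_fplm n R M F \<longrightarrow>
    (\<exists>S :: nat spn.
       dc_spn n R M S \<and>
       circuit_size (spn_circuit S) \<le> C * (n * (fplm_dim F)\<^sup>2) \<and>
       (\<forall>x \<in> Pi {1..n} R. spn_fun S x = fplm_fun n F x))"
proof (intro exI[of _ 5] allI impI)
  fix n :: nat and R :: "nat \<Rightarrow> real set" and M :: "nat \<Rightarrow> real measure" and F :: fplm
  assume n: "1 \<le> n" and dim: "1 \<le> fplm_dim F" and F: "is_fplm n R M F"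
  have "dc_spn n R M (fplm_spn n F)"
    using is_spn_fplm_spn[OF F dim] decomposable_fplm_spn[OF F] complete_fplm_spn
    by (simp add: dc_spn_def)
  moreover have "circuit_size (spn_circuit (fplm_spn n F)) \<le> 5 * (n * (fplm_dim F)\<^sup>2)"
    using circuit_size_fplm_circuit[OF n dim] by (simp add: fplm_spn_def)
  ultimately show "\<exists>S :: nat spn. dc_spn n R M S \<and>
      circuit_size (spn_circuit S) \<le> 5 * (n * (fplm_dim F)\<^sup>2) \<and>
      (\<forall>x \<in> Pi {1..n} R. spn_fun S x = fplm_fun n F x)"
    using spn_fun_fplm_spn[OF F dim] by blast
qed

end
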